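(* Let $(H,K,\rightharpoonup,\leftharpoonup)$ be a matched pair of Hopf algebras and let $\pi:K\to H$ be a Hopf algebra homomorphism satisfying $$\pi(x_1\rightharpoonup a_1)(x_2\leftharpoonup a_2)=x\,\pi(a),\qquad\forall a\in K,\ x\in H.$$ Define two binary products on $K$ by $$a\rightharpoonup_\pi b=\pi(a)\rightharpoonup b,\qquad a\leftharpoonup_\pi b=S_K(\pi(a_1)\rightharpoonup b_1)\,a_2b_2,\qquad\forall a,b\in K.$$ If the map $\leftharpoonup_\pi:K\otimes K\to K$ is a coalgebra homomorphism, then the triple $(K,\rightharpoonup_\pi,\leftharpoonup_\pi)$ is a matched pair of actions on $K$.
   Context: Everything is over a fixed arbitrary field $\mathbf{k}$; Sweedler notation $\Delta(x)=x_1\otimes x_2$; $S_K$ is the antipode of $K$. A matched pair of Hopf algebras $(H,K,\rightharpoonup,\leftharpoonup)$ consists of Hopf algebras $H,K$, a left $H$-module coalgebra action $\rightharpoonup:H\otimes K\to K$ on $K$ and a right $K$-module coalgebra action $\leftharpoonup:H\otimes K\to H$ on $H$ (so both maps are module actions and coalgebra maps) such that for all $x,y\in H$, $a,b\in K$: $x\rightharpoonup ab=(x_1\rightharpoonup a_1)((x_2\leftharpoonup a_2)\rightharpoonup b)$; $x\rightharpoonup 1_K=\varepsilon_H(x)1_K$; $xy\leftharpoonup a=(x\leftharpoonup(y_1\rightharpoonup a_1))(y_2\leftharpoonup a_2)$; $1_H\leftharpoonup a=\varepsilon_K(a)1_H$; $(x_1\rightharpoonup a_1)\otimes(x_2\leftharpoonup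 a_2)=(x_2\rightharpoonup a_2)\otimes(x_1\leftharpoonup a_1)$. A matched pair of actions on a Hopf algebra $H$, written $(H,\rightharpoonup,\leftharpoonup)$, is a matched pair of Hopf algebras $(H,H,\rightharpoonup,\leftharpoonup)$ satisfying $xy=(x_1\rightharpoonup y_1)(x_2\leftharpoonup y_2)$ for all $x,y\in H$. *)

theory Defs
  imports Complex_Main
begin

section \<open>Tensor products\<close>

text \<open>
  The library has no tensor product of vector spaces over an arbitrary field.  We use the usual
  presentation: an element of $A \otimes B$ is represented by a formal finite sum of pure tensors
  (a list of pairs), and two formal sums are identified by the least congruence for addition of
  formal sums that contains the bilinearity relations.  The threefold tensor product
  $A \otimes B \otimes C$ is presented in the same way by the multilinearity relations.  A linear
  map into a tensor product is thus given by a choice of representatives, with all equations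
  understood modulo the congruence; a linear map out of $A \otimes B$ is given by a bilinear map.
\<close>

inductive formal_sum_eq :: "('t list \<Rightarrow> 't list \<Rightarrow> bool) \<Rightarrow> 't list \<Rightarrow> 't list \<Rightarrow> bool"
  for R where
  gen: "R u v \<Longrightarrow> formal_sum_eq R u v"
| refl: "formal_sum_eq R u u"
| sym: "formal_sum_eq R u v \<Longrightarrow> formal_sum_eq R v u"
| trans: "formal_sum_eq R u v \<Longrightarrow> formal_sum_eq R v w \<Longrightarrow> formal_sum_eq R u w"
| plus: "formal_sum_eq R u v \<Longrightarrow> formal_sum_eq R u' v' \<Longrightarrow> formal_sum_eq R (u @ u') (v @ v')"
| comm: "formal_sum_eq R (u @ v) (v @ u)"

text \<open>
  The relation \<open>(0, b) = 0\<close> is listed because formal sums only form a monoid; together with the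
  others it makes the quotient a group, the opposite of \<open>(a, b)\<close> being \<open>(- a, b)\<close>.
\<close>

inductive bilinear_rel ::
  "('f::field \<Rightarrow> 'a::ab_group_add \<Rightarrow> 'a) \<Rightarrow> ('f \<Rightarrow> 'b::ab_group_add \<Rightarrow> 'b) \<Rightarrow>
    ('a \<times> 'b) list \<Rightarrow> ('a \<times> 'b) list \<Rightarrow> bool"
  for s t where
  add_left: "bilinear_rel s t [(a + a', b)] [(a, b), (a', b)]"
| add_right: "bilinear_rel s t [(a, b + b')] [(a, b), (a, b')]"
| balance: "bilinear_rel s t [(s k a, b)] [(a, t k b)]"
| zero: "bilinear_rel s t [(0, b)] []"

inductive trilinear_rel ::
  "('f::field \<Rightarrow> 'a::ab_group_add \<Rightarrow> 'a) \<Rightarrow> ('f \<Rightarrow> 'b::ab_group_add \<Rightarrow> 'b) \<Rightarrow>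
    ('f \<Rightarrow> 'c::ab_group_add \<Rightarrow> 'c) \<Rightarrow> ('a \<times> 'b \<times> 'c) list \<Rightarrow> ('a \<times> 'b \<times> 'c) list \<Rightarrow> bool"
  for s t r where
  add1: "trilinear_rel s t r [(a + a', b, c)] [(a, b, c), (a', b, c)]"
| add2: "trilinear_rel s t r [(a, b + b', c)] [(a, b, c), (a, b', c)]"
| add3: "trilinear_rel s t r [(a, b, c + c')] [(a, b, c), (a, b, c')]"
| balance12: "trilinear_rel s t r [(s k a, b, c)] [(a, t k b, c)]"
| balance23: "trilinear_rel s t r [(a, t k b, c)] [(a, b, r k c)]"
| zero: "trilinear_rel s t r [(0, b, c)] []"

abbreviation "tensor_eq s t \<equiv> formal_sum_eq (bilinear_rel s t)"

abbreviation "tensor3_eq s t r \<equiv> formal_sum_eq (trilinear_rel s t r)"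

definition bilinear_map ::
  "('f::field \<Rightarrow> 'a::ab_group_add \<Rightarrow> 'a) \<Rightarrow> ('f \<Rightarrow> 'b::ab_group_add \<Rightarrow> 'b) \<Rightarrow>
    ('f \<Rightarrow> 'c::ab_group_add \<Rightarrow> 'c) \<Rightarrow> ('a \<Rightarrow> 'b \<Rightarrow> 'c) \<Rightarrow> bool" where
  "bilinear_map s t r f \<longleftrightarrow>
    (\<forall>b. Vector_Spaces.linear s r (\<lambda>a. f a b)) \<and> (\<forall>a. Vector_Spaces.linear t r (f a))"

text \<open>Bilinear maps are well defined on the tensor product, so Sweedler sums do not depend on the
  chosen representatives.\<close>

lemma tensor_eq_imp_sum_eq:
  assumes "tensor_eq s t u v" and f: "bilinear_map s t r f"
  shows "(\<Sum>(a, b)\<leftarrow>u. f a b) = (\<Sum>(a, b)\<leftarrow>v. f a b)"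
proof -
  have l1: "Vector_Spaces.linear s r (\<lambda>a. f a b)" for b
    using f by (simp add: bilinear_map_def)
  have l2: "Vector_Spaces.linear t r (f a)" for a
    using f by (simp add: bilinear_map_def)
  note h1 = Vector_Spaces.linear.axioms(3)[OF l1] and h2 = Vector_Spaces.linear.axioms(3)[OF l2]
  show ?thesis
    using assms(1)
  proof (induction rule: formal_sum_eq.induct)
    case (gen u v)
    then show ?case
      by cases (simp_all add: module_hom.add[OF h1] module_hom.add[OF h2]
          module_hom.scale[OF h1] module_hom.scale[OF h2] module_hom.zero[OF h1])
  qed (simp_all add: add.commute)
qed

section \<open>Hopf algebras\<close>

text \<open>
  The ring structure of the algebra is that of its type.  The class \<^class>\<open>ring_1\<close> requires
  \<open>0 \<noteq> 1\<close>, which is no restriction since a counit satisfies \<open>\<epsilon>(1) = 1\<close>.  The comultiplication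
  returns a formal sum representing an element of the tensor square, so that
  \<open>\<Sum>(x\<^sub>1, x\<^sub>2)\<leftarrow>comult H x. f x\<^sub>1 x\<^sub>2\<close> is Sweedler notation.
\<close>

record ('f, 'a) hopf =
  smul :: "'f \<Rightarrow> 'a \<Rightarrow> 'a"
  comult :: "'a \<Rightarrow> ('a \<times> 'a) list"
  counit :: "'a \<Rightarrow> 'f"
  antipode :: "'a \<Rightarrow> 'a"

locale hopf_algebra = vector_space "smul H" for H :: "('f::field, 'a::ring_1) hopf" +
  assumes smul_mult_left: "smul H k x * y = smul H k (x * y)"
    and smul_mult_right: "x * smul H k y = smul H k (x * y)"
    and comult_add: "tensor_eq (smul H) (smul H) (comult H (x + y)) (comult H x @ comult H y)"
    and comult_smul: "tensor_eq (smul H) (smul H)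
      (comult H (smul H k x)) [(smul H k x1, x2). (x1, x2) \<leftarrow> comult H x]"
    and linear_counit: "Vector_Spaces.linear (smul H) (*) (counit H)"
    and coassoc: "tensor3_eq (smul H) (smul H) (smul H)
      [(x11, x12, x2). (x1, x2) \<leftarrow> comult H x, (x11, x12) \<leftarrow> comult H x1]
      [(x1, x21, x22). (x1, x2) \<leftarrow> comult H x, (x21, x22) \<leftarrow> comult H x2]"
    and counit_left: "(\<Sum>(x1, x2)\<leftarrow>comult H x. smul H (counit H x1) x2) = x"
    and counit_right: "(\<Sum>(x1, x2)\<leftarrow>comult H x. smul H (counit H x2) x1) = x"
    and comult_mult: "tensor_eq (smul H) (smul H) (comult H (x * y))
      [(x1 * y1, x2 * y2). (x1, x2) \<leftarrow> comult H x, (y1, y2) \<leftarrow> comult H y]"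
    and comult_one: "tensor_eq (smul H) (smul H) (comult H 1) [(1, 1)]"
    and counit_mult: "counit H (x * y) = counit H x * counit H y"
    and counit_one: "counit H 1 = 1"
    and linear_antipode: "Vector_Spaces.linear (smul H) (smul H) (antipode H)"
    and antipode_left: "(\<Sum>(x1, x2)\<leftarrow>comult H x. antipode H x1 * x2) = smul H (counit H x) 1"
    and antipode_right: "(\<Sum>(x1, x2)\<leftarrow>comult H x. x1 * antipode H x2) = smul H (counit H x) 1"

text \<open>Preservation of the antipodes is a consequence of the conditions below.\<close>

definition hopf_hom ::
  "('f::field, 'a::ring_1) hopf \<Rightarrow> ('f, 'b::ring_1) hopf \<Rightarrow> ('a \<Rightarrow> 'b) \<Rightarrow> bool" where
  "hopf_hom A B f \<longleftrightarrow>
    Vector_Spaces.linear (smul A) (smul B) f \<and>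
    (\<forall>x y. f (x * y) = f x * f y) \<and> f 1 = 1 \<and>
    (\<forall>x. tensor_eq (smul B) (smul B)
      (comult B (f x)) [(f x1, f x2). (x1, x2) \<leftarrow> comult A x]) \<and>
    (\<forall>x. counit B (f x) = counit A x)"

text \<open>A bilinear \<open>f\<close>, regarded as a linear map $A \otimes B \to C$, is a coalgebra homomorphism for
  the tensor product coalgebra $A \otimes B$.\<close>

definition tensor_coalgebra_hom ::
  "('f::field, 'a::ring_1) hopf \<Rightarrow> ('f, 'b::ring_1) hopf \<Rightarrow> ('f, 'c::ring_1) hopf \<Rightarrow>
    ('a \<Rightarrow> 'b \<Rightarrow> 'c) \<Rightarrow> bool" where
  "tensor_coalgebra_hom A B C f \<longleftrightarrow>
    bilinear_map (smul A) (smul B) (smul C) f \<and>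
    (\<forall>a b. tensor_eq (smul C) (smul C) (comult C (f a b))
      [(f a1 b1, f a2 b2). (a1, a2) \<leftarrow> comult A a, (b1, b2) \<leftarrow> comult B b]) \<and>
    (\<forall>a b. counit C (f a b) = counit A a * counit B b)"

definition left_module_coalgebra ::
  "('f::field, 'h::ring_1) hopf \<Rightarrow> ('f, 'k::ring_1) hopf \<Rightarrow> ('h \<Rightarrow> 'k \<Rightarrow> 'k) \<Rightarrow> bool" where
  "left_module_coalgebra H K act \<longleftrightarrow>
    tensor_coalgebra_hom H K K act \<and>
    (\<forall>x y a. act (x * y) a = act x (act y a)) \<and> (\<forall>a. act 1 a = a)"

definition right_module_coalgebra ::
  "('f::field, 'k::ring_1) hopf \<Rightarrow> ('f, 'h::ring_1) hopf \<Rightarrow> ('h \<Rightarrow> 'k \<Rightarrow> 'h) \<Rightarrow> bool" where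
  "right_module_coalgebra K H act \<longleftrightarrow>
    tensor_coalgebra_hom H K H act \<and>
    (\<forall>x a b. act x (a * b) = act (act x a) b) \<and> (\<forall>x. act x 1 = x)"

section \<open>Matched pairs\<close>

locale matched_pair =
  H: hopf_algebra H + K: hopf_algebra K
  for H :: "('f::field, 'h::ring_1) hopf" and K :: "('f, 'k::ring_1) hopf"
    and lact :: "'h \<Rightarrow> 'k \<Rightarrow> 'k" (infix "\<rightharpoonup>" 75)
    and ract :: "'h \<Rightarrow> 'k \<Rightarrow> 'h" (infix "\<leftharpoonup>" 75) +
  assumes left_module_coalgebra: "left_module_coalgebra H K (\<rightharpoonup>)"
    and right_module_coalgebra: "right_module_coalgebra K H (\<leftharpoonup>)"
    and lact_mult: "x \<rightharpoonup> (a * b) =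
      (\<Sum>(x1, x2)\<leftarrow>comult H x. \<Sum>(a1, a2)\<leftarrow>comult K a. (x1 \<rightharpoonup> a1) * ((x2 \<leftharpoonup> a2) \<rightharpoonup> b))"
    and lact_one: "x \<rightharpoonup> 1 = smul K (counit H x) 1"
    and ract_mult: "(x * y) \<leftharpoonup> a =
      (\<Sum>(y1, y2)\<leftarrow>comult H y. \<Sum>(a1, a2)\<leftarrow>comult K a. (x \<leftharpoonup> (y1 \<rightharpoonup> a1)) * (y2 \<leftharpoonup> a2))"
    and ract_one: "1 \<leftharpoonup> a = smul H (counit K a) 1"
    and lact_ract_swap: "tensor_eq (smul K) (smul H)
      [(x1 \<rightharpoonup> a1, x2 \<leftharpoonup> a2). (x1, x2) \<leftarrow> comult H x, (a1, a2) \<leftarrow> comult K a]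
      [(x2 \<rightharpoonup> a2, x1 \<leftharpoonup> a1). (x1, x2) \<leftarrow> comult H x, (a1, a2) \<leftarrow> comult K a]"

locale matched_pair_of_actions =
  matched_pair H H lact ract
  for H :: "('f::field, 'h::ring_1) hopf"
    and lact :: "'h \<Rightarrow> 'h \<Rightarrow> 'h" (infix "\<rightharpoonup>" 75)
    and ract :: "'h \<Rightarrow> 'h \<Rightarrow> 'h" (infix "\<leftharpoonup>" 75) +
  assumes mult_eq: "x * y =
      (\<Sum>(x1, x2)\<leftarrow>comult H x. \<Sum>(y1, y2)\<leftarrow>comult H y. (x1 \<rightharpoonup> y1) * (x2 \<leftharpoonup> y2))"

definition lact_of_hom :: "('h \<Rightarrow> 'k \<Rightarrow> 'k) \<Rightarrow> ('k \<Rightarrow> 'h) \<Rightarrow> 'k \<Rightarrow> 'k \<Rightarrow> 'k" where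
  "lact_of_hom lact \<pi> a b = lact (\<pi> a) b"

definition ract_of_hom ::
  "('f::field, 'k::ring_1) hopf \<Rightarrow> ('h \<Rightarrow> 'k \<Rightarrow> 'k) \<Rightarrow> ('k \<Rightarrow> 'h) \<Rightarrow> 'k \<Rightarrow> 'k \<Rightarrow> 'k" where
  "ract_of_hom K lact \<pi> a b =
    (\<Sum>(a1, a2)\<leftarrow>comult K a. \<Sum>(b1, b2)\<leftarrow>comult K b. antipode K (lact (\<pi> a1) b1) * (a2 * b2))"

end

theory Submission
  imports Defs
begin

text \<open>
  Write $a \triangleright b = \pi(a) \rightharpoonup b$ and
  $a \triangleleft b = S(a_1 \triangleright b_1)\, a_2 b_2$.  Convolving with the inverse
  $S(a \triangleright b)$ of $a \triangleright b$ gives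
  $(a_1 \triangleright b_1)(a_2 \triangleleft b_2) = ab$ and, using the hypothesis on $\pi$,
  $\pi(a \triangleleft b) = \pi(a) \leftharpoonup b$; the latter transports the rule for
  $x \rightharpoonup ab$ to $\triangleright$.  Since both maps are coalgebra homomorphisms,
  comultiplying $ab = (a_1 \triangleright b_1)(a_2 \triangleleft b_2)$ yields
  $(a_1 \triangleright b_1)(a_2 \triangleleft b_2) \otimes (a_3 \triangleright b_3)(a_4 \triangleleft b_4)
   = (a_1 \triangleright b_1)(a_3 \triangleleft b_3) \otimes (a_2 \triangleright b_2)(a_4 \triangleleft b_4)$,
  and cancelling the outer factors gives the compatibility
  $a_1 \triangleleft b_1 \otimes a_2 \triangleright b_2 = a_2 \triangleleft b_2 \otimes a_1 \triangleright b_1$.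
  This, together with $S(xy) = S(y)S(x)$, makes $\triangleleft$ a module action.
\<close>

section \<open>Formal sums and multilinear maps\<close>

lemma formal_sum_eq_map_cong:
  assumes "\<And>x. x \<in> set xs \<Longrightarrow> formal_sum_eq R [f x] (g x)"
  shows "formal_sum_eq R (map f xs) (concat (map g xs))"
  using assms
proof (induction xs)
  case (Cons x xs)
  have "formal_sum_eq R ([f x] @ map f xs) (g x @ concat (map g xs))"
    using Cons by (intro formal_sum_eq.plus) auto
  then show ?case by simp
qed (simp add: formal_sum_eq.refl)

lemma formal_sum_eq_append_append:
  "formal_sum_eq R ((u @ v) @ (u' @ v')) ((u @ u') @ (v @ v'))"
proof -
  have "formal_sum_eq R (u @ ((v @ u') @ v')) (u @ ((u' @ v) @ v'))"
    by (intro formal_sum_eq.plus formal_sum_eq.refl formal_sum_eq.comm)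
  then show ?thesis by simp
qed

lemma formal_sum_eq_map_append:
  assumes "\<And>x. formal_sum_eq R [h x] [f x, g x]"
  shows "formal_sum_eq R (map h xs) (map f xs @ map g xs)"
proof (induction xs)
  case (Cons x xs)
  have "formal_sum_eq R ([h x] @ map h xs) ([f x, g x] @ (map f xs @ map g xs))"
    using assms Cons by (intro formal_sum_eq.plus)
  moreover have "formal_sum_eq R (([f x] @ [g x]) @ (map f xs @ map g xs))
      (([f x] @ map f xs) @ ([g x] @ map g xs))"
    by (rule formal_sum_eq_append_append)
  ultimately show ?case
    by (auto intro: formal_sum_eq.trans)
qed (simp add: formal_sum_eq.refl)

lemma tensor_eq_sum_list_left:
  "tensor_eq s t [(\<Sum>x\<leftarrow>xs. f x, c)] (map (\<lambda>x. (f x, c)) xs)"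
proof (induction xs)
  case Nil
  then show ?case by (simp add: formal_sum_eq.gen bilinear_rel.zero)
next
  case (Cons x xs)
  have "tensor_eq s t [(f x + (\<Sum>x\<leftarrow>xs. f x), c)] ([(f x, c)] @ [(\<Sum>x\<leftarrow>xs. f x, c)])"
    by (auto intro: formal_sum_eq.gen bilinear_rel.add_left)
  moreover have "tensor_eq s t ([(f x, c)] @ [(\<Sum>x\<leftarrow>xs. f x, c)]) 
     ([(f x, c)] @ map (\<lambda>x. (f x, c)) xs)"
    using Cons by (intro formal_sum_eq.plus formal_sum_eq.refl)
  ultimately show ?case by (auto intro: formal_sum_eq.trans)
qed

text \<open>Expanding the left factors in a basis brings a formal sum into a normal form whose
  coefficients are values of bilinear maps.\<close>

lemma tensor_eqI:
  fixes s :: "'f::field \<Rightarrow> 'a::ab_group_add \<Rightarrow> 'a" and t :: "'f \<Rightarrow> 'b::ab_group_add \<Rightarrow> 'b"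
  assumes "vector_space s" "vector_space t"
    and eq: "\<And>f. bilinear_map s t t f \<Longrightarrow> (\<Sum>(a, b)\<leftarrow>u. f a b) = (\<Sum>(a, b)\<leftarrow>v. f a b)"
  shows "tensor_eq s t u v"
proof -
  interpret A: vector_space s by fact
  interpret B: vector_space t by fact
  define E where "E = A.extend_basis {}"
  have E: "A.independent E" "A.span E = UNIV"
    using A.independent_extend_basis[of "{}"] A.span_extend_basis[of "{}"]
    by (simp_all add: E_def A.independent_empty)
  define rep where "rep = A.representation E"
  \<comment> \<open>Finite set of all basis vectors occurring in left factors of \<open>u\<close> or
    \<open>v\<close>; the common index list \<open>bs\<close> makes the two normal forms comparable
    entry by entry.\<close>
  define S where "S = (\<Union>(a, c)\<in>set (u @ v). {b. rep a b \<noteq> 0})"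
  have "finite S"
    unfolding S_def rep_def by (auto simp: A.finite_representation)
  then obtain bs where bs: "set bs = S" "distinct bs"
    using finite_distinct_list by blast
  \<comment> \<open>Each coefficient of the normal form is a bilinear map into the right factor, so
    testing against maps with values in that factor suffices.\<close>
  have bil: "bilinear_map s t t (\<lambda>a c. t (rep a b) c)" for b
    using E unfolding bilinear_map_def Vector_Spaces.linear_iff rep_def
    by (auto simp: A.representation_add A.representation_scale B.scale_left_distrib
        B.scale_right_distrib B.scale_scale mult.commute assms)
  define N where "N w = map (\<lambda>b. (b, \<Sum>(a, c)\<leftarrow>w. t (rep a b) c)) bs" for w
  have pure: "tensor_eq s t [(a, c)] (map (\<lambda>b. (b, t (rep a b) c)) bs)"
    if "{b. rep a b \<noteq> 0} \<subseteq> S" for a c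
  proof -
    have "a = (\<Sum>b | rep a b \<noteq> 0. s (rep a b) b)"
      using A.sum_nonzero_representation_eq[OF E(1), of a] E(2) by (simp add: rep_def)
    also have "\<dots> = (\<Sum>b\<in>S. s (rep a b) b)"
      using that \<open>finite S\<close> by (intro sum.mono_neutral_left) auto
    also have "\<dots> = (\<Sum>b\<leftarrow>bs. s (rep a b) b)"
      using bs by (simp add: sum_list_distinct_conv_sum_set)
    finally have "a = (\<Sum>b\<leftarrow>bs. s (rep a b) b)" .
    then have "tensor_eq s t [(a, c)] (map (\<lambda>b. (s (rep a b) b, c)) bs)"
      using tensor_eq_sum_list_left[of s t "\<lambda>b. s (rep a b) b" bs c] by simp
    moreover have "tensor_eq s t (map (\<lambda>b. (s (rep a b) b, c)) bs)
        (concat (map (\<lambda>b. [(b, t (rep a b) c)]) bs))"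
      by (intro formal_sum_eq_map_cong formal_sum_eq.gen bilinear_rel.balance)
    ultimately show ?thesis
      by (auto intro: formal_sum_eq.trans simp: concat_map_singleton)
  qed
  have N: "tensor_eq s t w (N w)" if "set w \<subseteq> set (u @ v)" for w
    using that
  proof (induction w)
    case Nil
    \<comment> \<open>The normal form of the empty sum consists of pairs \<open>(b, 0)\<close>. Only
      a zero on the left is a generator, so the scalar 0 is moved across by
      \<open>balance\<close>.\<close>
    have "tensor_eq s t [(b, 0)] []" for b
    proof -
      have "tensor_eq s t [(s 0 b, 0)] [(b, t 0 0)]"
        by (intro formal_sum_eq.gen bilinear_rel.balance)
      moreover have "tensor_eq s t [(s 0 b, 0)] []"
        by (simp add: formal_sum_eq.gen bilinear_rel.zero)
      ultimately show ?thesis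
        by (auto intro: formal_sum_eq.trans formal_sum_eq.sym)
    qed
    then have "tensor_eq s t (N []) (concat (map (\<lambda>b. []) bs))"
      unfolding N_def by (intro formal_sum_eq_map_cong) simp
    moreover have "concat (map (\<lambda>b. []) bs) = ([] :: ('a \<times> 'b) list)"
      by (induction bs) auto
    ultimately show ?case by (auto intro: formal_sum_eq.sym)
  next
    case (Cons p w)
    obtain a c where p: "p = (a, c)" by fastforce
    have "{b. rep a b \<noteq> 0} \<subseteq> S"
      using Cons.prems p unfolding S_def by auto
    then have "tensor_eq s t ([(a, c)] @ w) (map (\<lambda>b. (b, t (rep a b) c)) bs @ N w)"
      using Cons by (intro formal_sum_eq.plus pure) auto
    \<comment> \<open>Normal forms are added basis vector by basis vector, using additivity in the
      right factor.\<close>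
    moreover have "tensor_eq s t (N (p # w)) (map (\<lambda>b. (b, t (rep a b) c)) bs @ N w)"
      unfolding N_def p
      by (simp, intro formal_sum_eq_map_append formal_sum_eq.gen bilinear_rel.add_right)
    ultimately show ?case
      unfolding p by (auto intro: formal_sum_eq.trans formal_sum_eq.sym)
  qed
  have "N u = N v"
    unfolding N_def using eq[OF bil] by simp
  then show ?thesis
    using N[of u] N[of v] by (auto intro: formal_sum_eq.trans formal_sum_eq.sym)
qed

section \<open>Multilinear maps and linearity of finite sums\<close>

definition trilinear_map ::
  "('f::field \<Rightarrow> 'a::ab_group_add \<Rightarrow> 'a) \<Rightarrow> ('f \<Rightarrow> 'v::ab_group_add \<Rightarrow> 'v) \<Rightarrow>
    ('a \<Rightarrow> 'a \<Rightarrow> 'a \<Rightarrow> 'v) \<Rightarrow> bool" where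
  "trilinear_map s r f \<longleftrightarrow>
    (\<forall>b c. Vector_Spaces.linear s r (\<lambda>a. f a b c)) \<and>
    (\<forall>a c. Vector_Spaces.linear s r (\<lambda>b. f a b c)) \<and>
    (\<forall>a b. Vector_Spaces.linear s r (\<lambda>c. f a b c))"

text \<open>Each generating relation is an instance of linearity in one argument. This turns
  \<open>coassoc\<close>, a congruence of formal sums, into an equation between values.\<close>

lemma tensor3_eq_imp_sum_eq:
  assumes "tensor3_eq s s s u v" and f: "trilinear_map s r f"
  shows "(\<Sum>(a, b, c)\<leftarrow>u. f a b c) = (\<Sum>(a, b, c)\<leftarrow>v. f a b c)"
  using assms(1)
proof (induction rule: formal_sum_eq.induct)
  have l: "Vector_Spaces.linear s r (\<lambda>a. f a b c)" "Vector_Spaces.linear s r (\<lambda>b. f a b c)"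
    "Vector_Spaces.linear s r (\<lambda>c. f a b c)" for a b c
    using f by (simp_all add: trilinear_map_def)
  case (gen u v)
  have z: "f 0 b c = 0" for b c
    using module_hom.zero[OF Vector_Spaces.linear.axioms(3)[OF l(1)]] .
  show ?case
    using gen by (cases rule: trilinear_rel.cases) (use l z in \<open>simp_all add: Vector_Spaces.linear_iff\<close>)
qed (simp_all add: add.commute)

text \<open>Linearity in one slot is phrased as a closure rule, so that multilinearity of a nested
  expression follows by backward chaining along its structure.\<close>

lemma bilinear_map_compose:
  assumes "bilinear_map s t r F"
  shows "Vector_Spaces.linear q s f \<Longrightarrow> Vector_Spaces.linear q r (\<lambda>x. F (f x) b)"
    and "Vector_Spaces.linear q t g \<Longrightarrow> Vector_Spaces.linear q r (\<lambda>x. F a (g x))"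
  using assms by (simp_all add: bilinear_map_def Vector_Spaces.linear_iff)

lemma trilinear_map_compose:
  assumes "trilinear_map s r F" "Vector_Spaces.linear q s f"
  shows "Vector_Spaces.linear q r (\<lambda>x. F (f x) b c)"
    and "Vector_Spaces.linear q r (\<lambda>x. F a (f x) c)"
    and "Vector_Spaces.linear q r (\<lambda>x. F a b (f x))"
  using assms by (simp_all add: trilinear_map_def Vector_Spaces.linear_iff)

lemma sum_list_swap:
  fixes f :: "'a \<Rightarrow> 'b \<Rightarrow> 'c::comm_monoid_add"
  shows "(\<Sum>x\<leftarrow>xs. \<Sum>y\<leftarrow>ys. f x y) = (\<Sum>y\<leftarrow>ys. \<Sum>x\<leftarrow>xs. f x y)"
  by (induction xs) (simp_all add: sum_list_addf)

lemma linear_sum_list: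
  assumes "Vector_Spaces.linear s t f"
  shows "f (\<Sum>x\<leftarrow>xs. g x) = (\<Sum>x\<leftarrow>xs. f (g x))"
proof -
  have "f 0 = 0"
    using module_hom.zero[OF Vector_Spaces.linear.axioms(3)[OF assms]] .
  then show ?thesis
    using assms by (induction xs) (simp_all add: Vector_Spaces.linear_iff)
qed

lemma linear_sum_listI:
  assumes "vector_space s" "vector_space t" "\<And>x. Vector_Spaces.linear s t (\<lambda>a. f a x)"
  shows "Vector_Spaces.linear s t (\<lambda>a. \<Sum>x\<leftarrow>xs. f a x)"
proof -
  interpret t: vector_space t by fact
  have l: "f (a + b) x = f a x + f b x" "f (s k a) x = t k (f a x)" for a b x k
    using assms(3) by (auto simp: Vector_Spaces.linear_iff)
  have "(\<Sum>x\<leftarrow>xs. f (a + b) x) = (\<Sum>x\<leftarrow>xs. f a x) + (\<Sum>x\<leftarrow>xs. f b x)"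
    "(\<Sum>x\<leftarrow>xs. f (s k a) x) = t k (\<Sum>x\<leftarrow>xs. f a x)" for a b k
    by (induction xs) (simp_all add: l t.scale_right_distrib algebra_simps)
  then show ?thesis
    using assms(1,2) by (simp add: Vector_Spaces.linear_iff)
qed

lemma sum_list_map_concat: "(\<Sum>x\<leftarrow>concat xss. f x) = (\<Sum>xs\<leftarrow>xss. \<Sum>x\<leftarrow>xs. f x)"
  for f :: "'a \<Rightarrow> 'b::monoid_add"
  by (induction xss) simp_all

section \<open>Sweedler calculus\<close>

context hopf_algebra
begin

text \<open>\<open>sweedler F x\<close> is $F(x_1, x_2)$ in Sweedler notation, and \<open>sweedler2 F a b\<close> is
  $F(a_1, b_1, a_2, b_2)$, the same for the coalgebra $H \otimes H$.  Both depend only on the tensor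
  represented by the formal sum when \<open>F\<close> is multilinear, hence the side conditions below.\<close>

definition sweedler :: "('a \<Rightarrow> 'a \<Rightarrow> 'v::ab_group_add) \<Rightarrow> 'a \<Rightarrow> 'v" where
  "sweedler F x = (\<Sum>(x1, x2)\<leftarrow>comult H x. F x1 x2)"

definition sweedler2 :: "('a \<Rightarrow> 'a \<Rightarrow> 'a \<Rightarrow> 'a \<Rightarrow> 'v::ab_group_add) \<Rightarrow> 'a \<Rightarrow> 'a \<Rightarrow> 'v" where
  "sweedler2 F a b = sweedler (\<lambda>a1 a2. sweedler (\<lambda>b1 b2. F a1 b1 a2 b2) b) a"

text \<open>\<open>comult\<close> is additive and homogeneous only modulo the tensor congruence; a
  bilinear \<open>F\<close> does not see the difference.\<close>

lemma sweedler_linear: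
  assumes "bilinear_map (smul H) (smul H) r F"
  shows "Vector_Spaces.linear (smul H) r (sweedler F)"
proof -
  have l: "Vector_Spaces.linear (smul H) r (\<lambda>a. F a b)" "Vector_Spaces.linear (smul H) r (F a)" for a b
    using assms by (simp_all add: bilinear_map_def)
  interpret r: vector_space r
    using l(1) by (simp add: Vector_Spaces.linear_iff)
  have "sweedler F (x + y) = sweedler F x + sweedler F y" for x y
    using tensor_eq_imp_sum_eq[OF comult_add assms, of x y] by (simp add: sweedler_def)
  moreover have "sweedler F (smul H k x) = r k (sweedler F x)" for k x
  proof -
    have "F (smul H k a) b = r k (F a b)" for a b
      using l(1) by (simp add: Vector_Spaces.linear_iff)
    moreover have "(\<Sum>(a, b)\<leftarrow>xs. r k (F a b)) = r k (\<Sum>(a, b)\<leftarrow>xs. F a b)" for xs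
      by (induction xs) (auto simp: r.scale_right_distrib)
    ultimately show ?thesis
      using tensor_eq_imp_sum_eq[OF comult_smul assms, of k x]
      by (simp add: sweedler_def comp_def case_prod_unfold)
  qed
  ultimately show ?thesis
    by (simp add: Vector_Spaces.linear_iff r.vector_space_axioms vector_space_axioms)
qed

lemma linear_apply_sweedler:
  assumes "Vector_Spaces.linear s t f"
  shows "f (sweedler G x) = sweedler (\<lambda>x1 x2. f (G x1 x2)) x"
  using linear_sum_list[OF assms] by (simp add: sweedler_def case_prod_unfold)

lemma sweedler_swap:
  "sweedler (\<lambda>a1 a2. sweedler (\<lambda>b1 b2. F a1 a2 b1 b2) b) a =
    sweedler (\<lambda>b1 b2. sweedler (\<lambda>a1 a2. F a1 a2 b1 b2) a) b"
  unfolding sweedler_def by (simp add: case_prod_unfold) (rule sum_list_swap)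

lemma sweedler_coassoc:
  assumes "trilinear_map (smul H) r F"
  shows "sweedler (\<lambda>x1 x2. sweedler (\<lambda>x11 x12. F x11 x12 x2) x1) x =
    sweedler (\<lambda>x1 x2. sweedler (\<lambda>x21 x22. F x1 x21 x22) x2) x"
  using tensor3_eq_imp_sum_eq[OF coassoc assms, of x]
  by (simp add: sweedler_def case_prod_unfold sum_list_map_concat comp_def)

lemma sweedler_mult:
  assumes "bilinear_map (smul H) (smul H) r F"
  shows "sweedler F (x * y) = sweedler2 (\<lambda>x1 y1 x2 y2. F (x1 * y1) (x2 * y2)) x y"
  using tensor_eq_imp_sum_eq[OF comult_mult assms, of x y]
  by (simp add: sweedler_def sweedler2_def case_prod_unfold sum_list_map_concat comp_def)

lemma sweedler_one:
  assumes "bilinear_map (smul H) (smul H) r F"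
  shows "sweedler F 1 = F 1 1"
  using tensor_eq_imp_sum_eq[OF comult_one assms] by (simp add: sweedler_def)

lemma antipode_one: "antipode H 1 = 1"
proof -
  have "bilinear_map (smul H) (smul H) (smul H) (\<lambda>x y. antipode H x * y)"
    using linear_antipode unfolding bilinear_map_def Vector_Spaces.linear_iff
    by (simp add: algebra_simps smul_mult_left smul_mult_right)
  from sweedler_one[OF this] antipode_left[of 1] show ?thesis
    by (simp add: sweedler_def counit_one scale_one)
qed

lemma linear_ident: "Vector_Spaces.linear (smul H) (smul H) (\<lambda>x. x)"
  by (simp add: Vector_Spaces.linear_iff vector_space_axioms)

lemma linear_mult_left:
  "Vector_Spaces.linear r (smul H) f \<Longrightarrow> Vector_Spaces.linear r (smul H) (\<lambda>x. f x * c)"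
  by (simp add: Vector_Spaces.linear_iff algebra_simps smul_mult_left)

lemma linear_mult_right:
  "Vector_Spaces.linear r (smul H) f \<Longrightarrow> Vector_Spaces.linear r (smul H) (\<lambda>x. c * f x)"
  by (simp add: Vector_Spaces.linear_iff algebra_simps smul_mult_right)

lemma linear_antipodeI:
  "Vector_Spaces.linear r (smul H) f \<Longrightarrow> Vector_Spaces.linear r (smul H) (\<lambda>x. antipode H (f x))"
  using linear_antipode by (simp add: Vector_Spaces.linear_iff)

text \<open>A variable can enter a Sweedler sum through the summand, as here, or through the
  comultiplied element, as in \<open>linear_sweedlerI\<close>. Nested sums need both rules.\<close>

lemma linear_sweedler_const:
  assumes "\<And>x1 x2. Vector_Spaces.linear r t (\<lambda>a. F a x1 x2)"
  shows "Vector_Spaces.linear r t (\<lambda>a. sweedler (F a) x)"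
  unfolding sweedler_def case_prod_unfold
  using assms by (intro linear_sum_listI) (auto simp: Vector_Spaces.linear_iff)

lemma linear_sweedlerI:
  assumes f: "Vector_Spaces.linear s (smul H) f"
    and "\<And>x2. Vector_Spaces.linear (smul H) r (\<lambda>x1. F x1 x2)"
    and "\<And>x1. Vector_Spaces.linear (smul H) r (\<lambda>x2. F x1 x2)"
  shows "Vector_Spaces.linear s r (\<lambda>a. sweedler F (f a))"
proof -
  have "bilinear_map (smul H) (smul H) r F"
    using assms by (simp add: bilinear_map_def)
  from sweedler_linear[OF this] f show ?thesis
    by (simp add: Vector_Spaces.linear_iff)
qed

lemmas linear_rules = linear_ident linear_mult_left linear_mult_right linear_antipodeI
  linear_sweedler_const linear_sweedlerI

definition multilinear6 ::
  "('f \<Rightarrow> 'v::ab_group_add \<Rightarrow> 'v) \<Rightarrow> ('a \<Rightarrow> 'a \<Rightarrow> 'a \<Rightarrow> 'a \<Rightarrow> 'a \<Rightarrow> 'a \<Rightarrow> 'v) \<Rightarrow> bool" where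
  "multilinear6 r F \<longleftrightarrow>
    (\<forall>b c d e f. Vector_Spaces.linear (smul H) r (\<lambda>x. F x b c d e f)) \<and>
    (\<forall>a c d e f. Vector_Spaces.linear (smul H) r (\<lambda>x. F a x c d e f)) \<and>
    (\<forall>a b d e f. Vector_Spaces.linear (smul H) r (\<lambda>x. F a b x d e f)) \<and>
    (\<forall>a b c e f. Vector_Spaces.linear (smul H) r (\<lambda>x. F a b c x e f)) \<and>
    (\<forall>a b c d f. Vector_Spaces.linear (smul H) r (\<lambda>x. F a b c d x f)) \<and>
    (\<forall>a b c d e. Vector_Spaces.linear (smul H) r (\<lambda>x. F a b c d e x))"

lemma sweedler2_coassoc:
  assumes F: "multilinear6 r F"
  shows "sweedler2 (\<lambda>a1 b1 a2 b2. sweedler2 (\<lambda>a11 b11 a12 b12. F a11 b11 a12 b12 a2 b2) a1 b1) a b =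
    sweedler2 (\<lambda>a1 b1 a2 b2. sweedler2 (\<lambda>a21 b21 a22 b22. F a1 b1 a21 b21 a22 b22) a2 b2) a b"
proof -
  have lin: "\<And>b c d e f. Vector_Spaces.linear (smul H) r (\<lambda>x. F x b c d e f)"
    "\<And>a c d e f. Vector_Spaces.linear (smul H) r (\<lambda>x. F a x c d e f)"
    "\<And>a b d e f. Vector_Spaces.linear (smul H) r (\<lambda>x. F a b x d e f)"
    "\<And>a b c e f. Vector_Spaces.linear (smul H) r (\<lambda>x. F a b c x e f)"
    "\<And>a b c d f. Vector_Spaces.linear (smul H) r (\<lambda>x. F a b c d x f)"
    "\<And>a b c d e. Vector_Spaces.linear (smul H) r (\<lambda>x. F a b c d e x)"
    using F by (simp_all add: multilinear6_def)
  note lin' = linear_ident linear_sweedler_const linear_sweedlerI lin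
  have "sweedler2 (\<lambda>a1 b1 a2 b2. sweedler2 (\<lambda>a11 b11 a12 b12. F a11 b11 a12 b12 a2 b2) a1 b1) a b =
    sweedler (\<lambda>a1 a2. sweedler (\<lambda>a11 a12. sweedler (\<lambda>b1 b2. sweedler (\<lambda>b11 b12.
      F a11 b11 a12 b12 a2 b2) b1) b) a1) a"
    unfolding sweedler2_def
    by (intro arg_cong[where f = "\<lambda>G. sweedler G a"] ext) (rule sweedler_swap)
  also have "\<dots> = sweedler (\<lambda>a1 a2. sweedler (\<lambda>a21 a22. sweedler (\<lambda>b1 b2. sweedler (\<lambda>b11 b12.
      F a1 b11 a21 b12 a22 b2) b1) b) a2) a"
    by (rule sweedler_coassoc[where r = r]) (unfold trilinear_map_def, fast intro: lin')
  also have "\<dots> = sweedler (\<lambda>a1 a2. sweedler (\<lambda>a21 a22. sweedler (\<lambda>b1 b2. sweedler (\<lambda>b21 b22.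
      F a1 b1 a21 b21 a22 b22) b2) b) a2) a"
    by (intro arg_cong[where f = "\<lambda>G. sweedler G _"] ext sweedler_coassoc[where r = r])
      (unfold trilinear_map_def, fast intro: lin')
  also have "\<dots> = sweedler2 (\<lambda>a1 b1 a2 b2. sweedler2 (\<lambda>a21 b21 a22 b22.
      F a1 b1 a21 b21 a22 b22) a2 b2) a b"
    unfolding sweedler2_def
    by (intro arg_cong[where f = "\<lambda>G. sweedler G a"] ext) (rule sweedler_swap)
  finally show ?thesis .
qed

lemma sweedler_counit_left:
  assumes "Vector_Spaces.linear (smul H) r f"
  shows "sweedler (\<lambda>x1 x2. r (counit H x1) (f x2)) x = f x"
proof -
  have "sweedler (\<lambda>x1 x2. f (smul H (counit H x1) x2)) x = f x"
    using linear_apply_sweedler[OF assms, of "\<lambda>x1 x2. smul H (counit H x1) x2" x] counit_left[of x]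
    by (simp add: sweedler_def)
  then show ?thesis using assms by (simp add: Vector_Spaces.linear_iff)
qed

lemma sweedler_counit_right:
  assumes "Vector_Spaces.linear (smul H) r f"
  shows "sweedler (\<lambda>x1 x2. r (counit H x2) (f x1)) x = f x"
proof -
  have "sweedler (\<lambda>x1 x2. f (smul H (counit H x2) x1)) x = f x"
    using linear_apply_sweedler[OF assms, of "\<lambda>x1 x2. smul H (counit H x2) x1" x] counit_right[of x]
    by (simp add: sweedler_def)
  then show ?thesis using assms by (simp add: Vector_Spaces.linear_iff)
qed

lemma linear_apply_sweedler2:
  assumes "Vector_Spaces.linear s t f"
  shows "f (sweedler2 G x y) = sweedler2 (\<lambda>a b c d. f (G a b c d)) x y"
  unfolding sweedler2_def by (simp add: linear_apply_sweedler[OF assms])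

lemma sweedler2_counit_left:
  assumes f: "bilinear_map (smul H) (smul H) r f"
  shows "sweedler2 (\<lambda>a1 b1 a2 b2. r (counit H a1 * counit H b1) (f a2 b2)) a b = f a b"
proof -
  note lin = bilinear_map_compose[OF f] linear_ident
  interpret r: vector_space r
    using lin(1)[OF linear_ident] by (simp add: Vector_Spaces.linear_iff)
  have r: "Vector_Spaces.linear r r (r k)" for k
    by (simp add: Vector_Spaces.linear_iff r.vector_space_axioms r.scale_right_distrib mult.commute)
  have "sweedler2 (\<lambda>a1 b1 a2 b2. r (counit H a1 * counit H b1) (f a2 b2)) a b =
      sweedler (\<lambda>a1 a2. r (counit H a1) (sweedler (\<lambda>b1 b2. r (counit H b1) (f a2 b2)) b)) a"
    by (simp add: sweedler2_def linear_apply_sweedler[OF r])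
  also have "\<dots> = sweedler (\<lambda>a1 a2. r (counit H a1) (f a2 b)) a"
    by (subst sweedler_counit_left) (fast intro: lin, simp)
  also have "\<dots> = f a b"
    by (rule sweedler_counit_left[where f = "\<lambda>a. f a b"]) (fast intro: lin)
  finally show ?thesis .
qed

lemma sweedler2_counit_right:
  assumes f: "bilinear_map (smul H) (smul H) r f"
  shows "sweedler2 (\<lambda>a1 b1 a2 b2. r (counit H a2 * counit H b2) (f a1 b1)) a b = f a b"
proof -
  note lin = bilinear_map_compose[OF f] linear_ident
  interpret r: vector_space r
    using lin(1)[OF linear_ident] by (simp add: Vector_Spaces.linear_iff)
  have r: "Vector_Spaces.linear r r (r k)" for k
    by (simp add: Vector_Spaces.linear_iff r.vector_space_axioms r.scale_right_distrib mult.commute)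
  have "sweedler2 (\<lambda>a1 b1 a2 b2. r (counit H a2 * counit H b2) (f a1 b1)) a b =
      sweedler (\<lambda>a1 a2. r (counit H a2) (sweedler (\<lambda>b1 b2. r (counit H b2) (f a1 b1)) b)) a"
    by (simp add: sweedler2_def linear_apply_sweedler[OF r])
  also have "\<dots> = sweedler (\<lambda>a1 a2. r (counit H a2) (f a1 b)) a"
    by (subst sweedler_counit_right) (fast intro: lin, simp)
  also have "\<dots> = f a b"
    by (rule sweedler_counit_right[where f = "\<lambda>a. f a b"]) (fast intro: lin)
  finally show ?thesis .
qed

section \<open>Cancelling coalgebra homomorphisms by the antipode\<close>

lemma sweedler_coalgebra_hom:
  assumes "tensor_coalgebra_hom H H H L" "bilinear_map (smul H) (smul H) r F"
  shows "sweedler F (L a b) = sweedler2 (\<lambda>a1 b1 a2 b2. F (L a1 b1) (L a2 b2)) a b"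
proof -
  have "tensor_eq (smul H) (smul H) (comult H (L a b))
      [(L a1 b1, L a2 b2). (a1, a2) \<leftarrow> comult H a, (b1, b2) \<leftarrow> comult H b]"
    using assms(1) by (simp add: tensor_coalgebra_hom_def)
  from tensor_eq_imp_sum_eq[OF this assms(2)] show ?thesis
    by (simp add: sweedler_def sweedler2_def case_prod_unfold sum_list_map_concat comp_def)
qed

text \<open>\<open>P\<close> stands for either antipode product, $S(x)y$ or $xS(y)$. As
  \<open>L\<close> respects comultiplication, its two values are the legs of \<open>L a b\<close>,
  on which \<open>P\<close> collapses to the counit.\<close>

lemma absorb_coalgebra_hom:
  assumes L: "tensor_coalgebra_hom H H H L"
    and P: "bilinear_map (smul H) (smul H) (smul H) P" "\<And>x. sweedler P x = smul H (counit H x) 1"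
    and G: "Vector_Spaces.linear (smul H) r G"
  shows "sweedler2 (\<lambda>a1 b1 a2 b2. G (P (L a1 b1) (L a2 b2))) a b =
    r (counit H a * counit H b) (G 1)"
proof -
  have "sweedler2 (\<lambda>a1 b1 a2 b2. G (P (L a1 b1) (L a2 b2))) a b =
      G (sweedler2 (\<lambda>a1 b1 a2 b2. P (L a1 b1) (L a2 b2)) a b)"
    by (simp add: linear_apply_sweedler2[OF G])
  also have "\<dots> = G (smul H (counit H (L a b)) 1)"
    by (simp add: sweedler_coalgebra_hom[OF L P(1), symmetric] P(2))
  also have "\<dots> = r (counit H a * counit H b) (G 1)"
    using G L by (simp add: Vector_Spaces.linear_iff tensor_coalgebra_hom_def)
  finally show ?thesis .
qed

text \<open>Coassociativity regroups the three legs so that the first two meet in \<open>P\<close>;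
  they collapse to counits, which are then absorbed by the remaining leg.\<close>

lemma absorb_left:
  assumes L: "tensor_coalgebra_hom H H H L"
    and P: "bilinear_map (smul H) (smul H) (smul H) P" "\<And>x. sweedler P x = smul H (counit H x) 1"
    and G: "trilinear_map (smul H) r G"
  shows "sweedler2 (\<lambda>a1 b1 a2 b2. sweedler2 (\<lambda>a21 b21 a22 b22.
    G (P (L a1 b1) (L a21 b21)) a22 b22) a2 b2) a b = G 1 a b"
proof -
  have bL: "bilinear_map (smul H) (smul H) (smul H) L"
    using L by (simp add: tensor_coalgebra_hom_def)
  note lin = trilinear_map_compose[OF G] bilinear_map_compose[OF P(1)] bilinear_map_compose[OF bL]
    linear_ident
  have "sweedler2 (\<lambda>a1 b1 a2 b2. sweedler2 (\<lambda>a21 b21 a22 b22.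
        G (P (L a1 b1) (L a21 b21)) a22 b22) a2 b2) a b =
      sweedler2 (\<lambda>a1 b1 a2 b2. sweedler2 (\<lambda>a11 b11 a12 b12.
        G (P (L a11 b11) (L a12 b12)) a2 b2) a1 b1) a b"
    by (rule sweedler2_coassoc[where r = r, symmetric]) (unfold multilinear6_def, fast intro: lin)
  also have "\<dots> = sweedler2 (\<lambda>a1 b1 a2 b2. r (counit H a1 * counit H b1) (G 1 a2 b2)) a b"
    by (subst absorb_coalgebra_hom[OF L P, where r = r]) (fast intro: lin, simp)
  also have "\<dots> = G 1 a b"
    by (rule sweedler2_counit_left) (unfold bilinear_map_def, fast intro: lin)
  finally show ?thesis .
qed

text \<open>Mirror image of \<open>absorb_left\<close>: the last two legs collapse and the first one
  survives.\<close>

lemma absorb_right: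
  assumes L: "tensor_coalgebra_hom H H H L"
    and P: "bilinear_map (smul H) (smul H) (smul H) P" "\<And>x. sweedler P x = smul H (counit H x) 1"
    and G: "trilinear_map (smul H) r G"
  shows "sweedler2 (\<lambda>a1 b1 a2 b2. sweedler2 (\<lambda>a11 b11 a12 b12.
    G (P (L a12 b12) (L a2 b2)) a11 b11) a1 b1) a b = G 1 a b"
proof -
  have bL: "bilinear_map (smul H) (smul H) (smul H) L"
    using L by (simp add: tensor_coalgebra_hom_def)
  note lin = trilinear_map_compose[OF G] bilinear_map_compose[OF P(1)] bilinear_map_compose[OF bL]
    linear_ident
  have "sweedler2 (\<lambda>a1 b1 a2 b2. sweedler2 (\<lambda>a11 b11 a12 b12.
        G (P (L a12 b12) (L a2 b2)) a11 b11) a1 b1) a b =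
      sweedler2 (\<lambda>a1 b1 a2 b2. sweedler2 (\<lambda>a21 b21 a22 b22.
        G (P (L a21 b21) (L a22 b22)) a1 b1) a2 b2) a b"
    by (rule sweedler2_coassoc[where r = r]) (unfold multilinear6_def, fast intro: lin)
  also have "\<dots> = sweedler2 (\<lambda>a1 b1 a2 b2. r (counit H a2 * counit H b2) (G 1 a1 b1)) a b"
    by (subst absorb_coalgebra_hom[OF L P, where r = r]) (fast intro: lin, simp)
  also have "\<dots> = G 1 a b"
    by (rule sweedler2_counit_right) (unfold bilinear_map_def, fast intro: lin)
  finally show ?thesis .
qed

lemma bilinear_antipode_mult:
  "bilinear_map (smul H) (smul H) (smul H) (\<lambda>x y. antipode H x * y)"
  "bilinear_map (smul H) (smul H) (smul H) (\<lambda>x y. x * antipode H y)"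
  unfolding bilinear_map_def by (fast intro: linear_rules)+

lemma sweedler_antipode:
  "sweedler (\<lambda>x y. antipode H x * y) x = smul H (counit H x) 1"
  "sweedler (\<lambda>x y. x * antipode H y) x = smul H (counit H x) 1"
  using antipode_left antipode_right by (simp_all add: sweedler_def)

lemmas absorb_antipode_left = absorb_left[OF _ bilinear_antipode_mult(1) sweedler_antipode(1)]
lemmas absorb_antipode_left' = absorb_left[OF _ bilinear_antipode_mult(2) sweedler_antipode(2)]
lemmas absorb_antipode_right = absorb_right[OF _ bilinear_antipode_mult(2) sweedler_antipode(2)]

text \<open>The convolution inverse of \<open>L\<close> is its composite with the antipode. The
  hypothesis quantifies over the multiplier \<open>y\<close> because it is applied with
  \<open>y * antipode H (L a1 b1)\<close> in its place.\<close>

lemma cancel_left: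
  assumes L: "tensor_coalgebra_hom H H H L"
    and A: "trilinear_map (smul H) r A" "trilinear_map (smul H) r A'"
    and eq: "\<And>y a b. sweedler2 (\<lambda>a1 b1 a2 b2. A (y * L a1 b1) a2 b2) a b =
      sweedler2 (\<lambda>a1 b1 a2 b2. A' (y * L a1 b1) a2 b2) a b"
  shows "A y a b = A' y a b"
proof -
  have *: "A y a b = sweedler2 (\<lambda>a1 b1 a2 b2. sweedler2 (\<lambda>a21 b21 a22 b22.
    A ((y * antipode H (L a1 b1)) * L a21 b21) a22 b22) a2 b2) a b"
    if A: "trilinear_map (smul H) r A" for A
  proof -
    have "trilinear_map (smul H) r (\<lambda>x. A (y * x))"
      unfolding trilinear_map_def by (fast intro: trilinear_map_compose[OF A] linear_rules)
    from absorb_antipode_left[OF L this, of a b] show ?thesis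
      by (simp add: mult.assoc)
  qed
  show ?thesis
    unfolding *[OF A(1)] *[OF A(2)] eq ..
qed

text \<open>Here the factor to be cancelled comes from the last leg and stands to the left of
  \<open>y\<close>, so the hypothesis is applied with
  \<open>antipode H (L a2 b2) * y\<close>.\<close>

lemma cancel_right:
  assumes L: "tensor_coalgebra_hom H H H L"
    and A: "trilinear_map (smul H) r A" "trilinear_map (smul H) r A'"
    and eq: "\<And>y a b. sweedler2 (\<lambda>a1 b1 a2 b2. A (L a2 b2 * y) a1 b1) a b =
      sweedler2 (\<lambda>a1 b1 a2 b2. A' (L a2 b2 * y) a1 b1) a b"
  shows "A y a b = A' y a b"
proof -
  have *: "A y a b = sweedler2 (\<lambda>a1 b1 a2 b2. sweedler2 (\<lambda>a11 b11 a12 b12.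
    A (L a12 b12 * (antipode H (L a2 b2) * y)) a11 b11) a1 b1) a b"
    if A: "trilinear_map (smul H) r A" for A
  proof -
    have "trilinear_map (smul H) r (\<lambda>x. A (x * y))"
      unfolding trilinear_map_def by (fast intro: trilinear_map_compose[OF A] linear_rules)
    from absorb_antipode_right[OF L this, of a b] show ?thesis
      by (simp add: mult.assoc)
  qed
  show ?thesis
    unfolding *[OF A(1)] *[OF A(2)] eq ..
qed

lemma tensor_coalgebra_hom_mult: "tensor_coalgebra_hom H H H (*)"
  unfolding tensor_coalgebra_hom_def bilinear_map_def
  using comult_mult counit_mult by (auto intro: linear_rules)

lemma antipode_mult: "antipode H (x * y) = antipode H y * antipode H x"
proof -
  let ?S = "antipode H"
  have r: "sweedler2 (\<lambda>a1 b1 a2 b2. a1 * b1 * (?S b2 * ?S a2)) a b = smul H (counit H a * counit H b) 1" for a b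
  proof -
    have "sweedler2 (\<lambda>a1 b1 a2 b2. a1 * b1 * (?S b2 * ?S a2)) a b =
      sweedler (\<lambda>a1 a2. a1 * sweedler (\<lambda>b1 b2. b1 * ?S b2) b * ?S a2) a"
      unfolding sweedler2_def
      by (simp add: linear_apply_sweedler[OF linear_mult_right[OF linear_ident]]
          linear_apply_sweedler[OF linear_mult_left[OF linear_ident]] mult.assoc)
    also have "\<dots> = smul H (counit H b) (sweedler (\<lambda>a1 a2. a1 * ?S a2) a)"
      by (subst linear_apply_sweedler[OF linear_scale_self])
        (simp add: sweedler_antipode smul_mult_left smul_mult_right)
    finally show ?thesis by (simp add: sweedler_antipode mult.commute)
  qed
  \<comment> \<open>The left inverse times the multiplication is inserted in front; regrouping lets
    the multiplication meet its right inverse instead.\<close>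
  have "?S y * ?S x = sweedler2 (\<lambda>a1 b1 a2 b2. sweedler2 (\<lambda>a21 b21 a22 b22.
     (?S (a1 * b1) * (a21 * b21)) * (?S b22 * ?S a22)) a2 b2) x y"
    using absorb_antipode_left[OF tensor_coalgebra_hom_mult, of "smul H" "\<lambda>x a b. x * (?S b * ?S a)" x y]
    unfolding trilinear_map_def by (fastforce intro: linear_rules)
  also have "\<dots> = sweedler2 (\<lambda>a1 b1 a2 b2. ?S (a1 * b1) * sweedler2 (\<lambda>a21 b21 a22 b22.
     a21 * b21 * (?S b22 * ?S a22)) a2 b2) x y"
    by (simp add: linear_apply_sweedler2[OF linear_mult_right[OF linear_ident]] mult.assoc)
  also have "\<dots> = sweedler2 (\<lambda>a1 b1 a2 b2. smul H (counit H a2 * counit H b2) (?S (a1 * b1))) x y"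
    by (simp add: r smul_mult_right)
  also have "\<dots> = ?S (x * y)"
    by (rule sweedler2_counit_right) (unfold bilinear_map_def, fast intro: linear_rules)
  finally show ?thesis ..
qed

text \<open>Regroups four legs from (1,2),(3,4) to 1,(2,3),4. This isolates the middle pair, whose
  order is what matters in comparing two expansions of a product.\<close>

lemma sweedler2_middle:
  assumes lin: "\<And>b1 a2 b2 a3 b3 a4 b4. Vector_Spaces.linear (smul H) r (\<lambda>x. F x b1 a2 b2 a3 b3 a4 b4)"
    "\<And>a1 a2 b2 a3 b3 a4 b4. Vector_Spaces.linear (smul H) r (\<lambda>x. F a1 x a2 b2 a3 b3 a4 b4)"
    "\<And>a1 b1 b2 a3 b3 a4 b4. Vector_Spaces.linear (smul H) r (\<lambda>x. F a1 b1 x b2 a3 b3 a4 b4)"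
    "\<And>a1 b1 a2 a3 b3 a4 b4. Vector_Spaces.linear (smul H) r (\<lambda>x. F a1 b1 a2 x a3 b3 a4 b4)"
    "\<And>a1 b1 a2 b2 b3 a4 b4. Vector_Spaces.linear (smul H) r (\<lambda>x. F a1 b1 a2 b2 x b3 a4 b4)"
    "\<And>a1 b1 a2 b2 a3 a4 b4. Vector_Spaces.linear (smul H) r (\<lambda>x. F a1 b1 a2 b2 a3 x a4 b4)"
    "\<And>a1 b1 a2 b2 a3 b3 b4. Vector_Spaces.linear (smul H) r (\<lambda>x. F a1 b1 a2 b2 a3 b3 x b4)"
    "\<And>a1 b1 a2 b2 a3 b3 a4. Vector_Spaces.linear (smul H) r (\<lambda>x. F a1 b1 a2 b2 a3 b3 a4 x)"
  shows "sweedler2 (\<lambda>a1 b1 a2 b2. sweedler2 (\<lambda>a11 b11 a12 b12. sweedler2 (\<lambda>a21 b21 a22 b22.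
      F a11 b11 a12 b12 a21 b21 a22 b22) a2 b2) a1 b1) a b =
    sweedler2 (\<lambda>a1 b1 a2 b2. sweedler2 (\<lambda>a21 b21 a22 b22. sweedler2 (\<lambda>p1 q1 p2 q2.
      F a1 b1 p1 q1 p2 q2 a22 b22) a21 b21) a2 b2) a b"
proof -
  note lin' = linear_ident linear_sweedler_const linear_sweedlerI lin
  have "sweedler2 (\<lambda>a1 b1 a2 b2. sweedler2 (\<lambda>a11 b11 a12 b12. sweedler2 (\<lambda>a21 b21 a22 b22.
      F a11 b11 a12 b12 a21 b21 a22 b22) a2 b2) a1 b1) a b =
    sweedler2 (\<lambda>a1 b1 a2 b2. sweedler2 (\<lambda>a21 b21 a22 b22. sweedler2 (\<lambda>p1 q1 p2 q2.
      F a1 b1 a21 b21 p1 q1 p2 q2) a22 b22) a2 b2) a b"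
    by (rule sweedler2_coassoc[where r = r])
      (unfold multilinear6_def sweedler2_def[of _ "_ :: 'a"], fast intro: lin')
  also have "\<dots> = sweedler2 (\<lambda>a1 b1 a2 b2. sweedler2 (\<lambda>a21 b21 a22 b22. sweedler2 (\<lambda>p1 q1 p2 q2.
      F a1 b1 p1 q1 p2 q2 a22 b22) a21 b21) a2 b2) a b"
    by (intro arg_cong[where f = "\<lambda>G. sweedler2 G _ _"] ext sweedler2_coassoc[where r = r, symmetric])
      (unfold multilinear6_def, fast intro: lin')
  finally show ?thesis .
qed

end

section \<open>The actions induced by the homomorphism\<close>

locale matched_pair_hom =
  matched_pair H K lact ract
  for H :: "('f::field, 'h::ring_1) hopf" and K :: "('f, 'k::ring_1) hopf"
    and lact :: "'h \<Rightarrow> 'k \<Rightarrow> 'k" (infix "\<rightharpoonup>" 75)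
    and ract :: "'h \<Rightarrow> 'k \<Rightarrow> 'h" (infix "\<leftharpoonup>" 75) +
  fixes \<pi> :: "'k \<Rightarrow> 'h"
  assumes hopf_hom: "hopf_hom K H \<pi>"
    and hom_mult_eq: "(\<Sum>(x1, x2)\<leftarrow>comult H x. \<Sum>(a1, a2)\<leftarrow>comult K a. \<pi> (x1 \<rightharpoonup> a1) * (x2 \<leftharpoonup> a2))
        = x * \<pi> a"
    and ract_coalgebra_hom: "tensor_coalgebra_hom K K K (ract_of_hom K (\<rightharpoonup>) \<pi>)"
begin

abbreviation left_action (infix "\<triangleright>" 75) where "a \<triangleright> b \<equiv> lact_of_hom (\<rightharpoonup>) \<pi> a b"
abbreviation right_action (infix "\<triangleleft>" 75) where "a \<triangleleft> b \<equiv> ract_of_hom K (\<rightharpoonup>) \<pi> a b"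
abbreviation "S \<equiv> antipode K"

section \<open>Transport along the Hopf algebra homomorphism\<close>

lemma linear_hom: "Vector_Spaces.linear (smul K) (smul H) \<pi>"
  and hom_mult: "\<pi> (a * b) = \<pi> a * \<pi> b"
  and hom_one: "\<pi> 1 = 1"
  and counit_hom: "counit H (\<pi> a) = counit K a"
  using hopf_hom by (simp_all add: hopf_hom_def)

lemma linear_homI:
  "Vector_Spaces.linear r (smul K) f \<Longrightarrow> Vector_Spaces.linear r (smul H) (\<lambda>x. \<pi> (f x))"
  using linear_hom by (simp add: Vector_Spaces.linear_iff)

lemma bilinear_lact: "bilinear_map (smul H) (smul K) (smul K) (\<rightharpoonup>)"
  and bilinear_ract: "bilinear_map (smul H) (smul K) (smul H) (\<leftharpoonup>)"
  using left_module_coalgebra right_module_coalgebra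
  by (simp_all add: left_module_coalgebra_def right_module_coalgebra_def tensor_coalgebra_hom_def)

lemma bilinear_left_action: "bilinear_map (smul K) (smul K) (smul K) (\<triangleright>)"
  unfolding bilinear_map_def lact_of_hom_def
  by (fast intro: bilinear_map_compose[OF bilinear_lact] linear_homI K.linear_ident)

lemma bilinear_right_action: "bilinear_map (smul K) (smul K) (smul K) (\<triangleleft>)"
  using ract_coalgebra_hom by (simp add: tensor_coalgebra_hom_def)

lemmas action_linear_rules = bilinear_map_compose[OF bilinear_lact]
  bilinear_map_compose[OF bilinear_ract] bilinear_map_compose[OF bilinear_left_action]
  bilinear_map_compose[OF bilinear_right_action] linear_homI K.linear_rules H.linear_rules

text \<open>Pulls a sum over the legs of \<open>\<pi> x\<close> in \<open>H\<close> back to a sum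
  over the legs of \<open>x\<close> in \<open>K\<close>.\<close>

lemma sweedler_hom:
  assumes "bilinear_map (smul H) (smul H) r F"
  shows "H.sweedler F (\<pi> x) = K.sweedler (\<lambda>x1 x2. F (\<pi> x1) (\<pi> x2)) x"
proof -
  have "tensor_eq (smul H) (smul H) (comult H (\<pi> x)) [(\<pi> x1, \<pi> x2). (x1, x2) \<leftarrow> comult K x]"
    using hopf_hom by (simp add: hopf_hom_def)
  from tensor_eq_imp_sum_eq[OF this assms] show ?thesis
    by (simp add: H.sweedler_def K.sweedler_def case_prod_unfold comp_def)
qed

lemma left_action_coalgebra_hom: "tensor_coalgebra_hom K K K (\<triangleright>)"
  unfolding tensor_coalgebra_hom_def
proof (intro conjI allI)
  show "bilinear_map (smul K) (smul K) (smul K) (\<triangleright>)"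
    by (rule bilinear_left_action)
  have hom: "tensor_coalgebra_hom H K K (\<rightharpoonup>)"
    using left_module_coalgebra by (simp add: left_module_coalgebra_def)
  fix a b
  show "counit K (a \<triangleright> b) = counit K a * counit K b"
    using hom by (simp add: tensor_coalgebra_hom_def lact_of_hom_def counit_hom)
  show "tensor_eq (smul K) (smul K) (comult K (a \<triangleright> b))
      [(a1 \<triangleright> b1, a2 \<triangleright> b2). (a1, a2) \<leftarrow> comult K a, (b1, b2) \<leftarrow> comult K b]"
  \<comment> \<open>Passing to values of bilinear test maps allows \<open>sweedler_hom\<close> to
    replace the legs of \<open>\<pi> a\<close>, which are known only up to the congruence.\<close>
  proof (rule tensor_eqI[OF K.vector_space_axioms K.vector_space_axioms])
    fix f assume f: "bilinear_map (smul K) (smul K) (smul K) f"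
    have "tensor_eq (smul K) (smul K) (comult K (\<pi> a \<rightharpoonup> b))
        [(x1 \<rightharpoonup> b1, x2 \<rightharpoonup> b2). (x1, x2) \<leftarrow> comult H (\<pi> a), (b1, b2) \<leftarrow> comult K b]"
      using hom by (simp add: tensor_coalgebra_hom_def)
    from tensor_eq_imp_sum_eq[OF this f]
    have "K.sweedler f (a \<triangleright> b) = H.sweedler (\<lambda>x1 x2. K.sweedler (\<lambda>b1 b2.
        f (x1 \<rightharpoonup> b1) (x2 \<rightharpoonup> b2)) b) (\<pi> a)"
      by (simp add: lact_of_hom_def H.sweedler_def K.sweedler_def case_prod_unfold
          sum_list_map_concat comp_def)
    also have "\<dots> = K.sweedler (\<lambda>a1 a2. K.sweedler (\<lambda>b1 b2. f (a1 \<triangleright> b1) (a2 \<triangleright> b2)) b) a"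
      unfolding lact_of_hom_def
      by (rule sweedler_hom[where r = "smul K"], unfold bilinear_map_def)
        (fast intro: bilinear_map_compose[OF f] action_linear_rules)
    finally show "(\<Sum>(x, y)\<leftarrow>comult K (a \<triangleright> b). f x y) = (\<Sum>(x, y)\<leftarrow>[(a1 \<triangleright> b1, a2 \<triangleright> b2).
        (a1, a2) \<leftarrow> comult K a, (b1, b2) \<leftarrow> comult K b]. f x y)"
      by (simp add: K.sweedler_def case_prod_unfold sum_list_map_concat comp_def)
  qed
qed

section \<open>Factorization of the product and the mixed multiplication rule\<close>

lemma right_action_eq: "a \<triangleleft> b = K.sweedler2 (\<lambda>a1 b1 a2 b2. S (a1 \<triangleright> b1) * (a2 * b2)) a b"
  by (simp add: ract_of_hom_def lact_of_hom_def K.sweedler2_def K.sweedler_def)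

lemma mult_eq_actions: "K.sweedler2 (\<lambda>a1 b1 a2 b2. (a1 \<triangleright> b1) * (a2 \<triangleleft> b2)) a b = a * b"
proof -
  have "trilinear_map (smul K) (smul K) (\<lambda>x a b. x * (a * b))"
    unfolding trilinear_map_def by (fast intro: K.linear_rules)
  from K.absorb_antipode_left'[OF left_action_coalgebra_hom this, of a b]
  show ?thesis
    by (simp add: right_action_eq mult.assoc
        K.linear_apply_sweedler2[OF K.linear_mult_right[OF K.linear_ident]])
qed

lemma hom_right_action: "\<pi> (a \<triangleleft> b) = \<pi> a \<leftharpoonup> b"
proof -
  have eq: "K.sweedler2 (\<lambda>a1 b1 a2 b2. \<pi> (a1 \<triangleright> b1) * (\<pi> a2 \<leftharpoonup> b2)) a b = \<pi> a * \<pi> b" for a b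
  proof -
    have "\<pi> a * \<pi> b = H.sweedler (\<lambda>x1 x2. K.sweedler (\<lambda>b1 b2. \<pi> (x1 \<rightharpoonup> b1) * (x2 \<leftharpoonup> b2)) b) (\<pi> a)"
      using hom_mult_eq[where x = "\<pi> a" and a = b] by (simp add: H.sweedler_def K.sweedler_def)
    also have "\<dots> = K.sweedler2 (\<lambda>a1 b1 a2 b2. \<pi> (a1 \<triangleright> b1) * (\<pi> a2 \<leftharpoonup> b2)) a b"
      unfolding lact_of_hom_def K.sweedler2_def
      by (rule sweedler_hom[where r = "smul H"], unfold bilinear_map_def)
        (fast intro: action_linear_rules)
    finally show ?thesis ..
  qed
  have tri: "trilinear_map (smul K) (smul H) (\<lambda>x a b. \<pi> x * (\<pi> a \<leftharpoonup> b))"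
    unfolding trilinear_map_def by (fast intro: action_linear_rules)
  have "\<pi> (a \<triangleleft> b) = K.sweedler2 (\<lambda>a1 b1 a2 b2. \<pi> (S (a1 \<triangleright> b1)) * (\<pi> a2 * \<pi> b2)) a b"
    by (simp add: right_action_eq K.linear_apply_sweedler2[OF linear_hom] hom_mult)
  also have "\<dots> = K.sweedler2 (\<lambda>a1 b1 a2 b2. K.sweedler2 (\<lambda>a21 b21 a22 b22.
      \<pi> (S (a1 \<triangleright> b1) * (a21 \<triangleright> b21)) * (\<pi> a22 \<leftharpoonup> b22)) a2 b2) a b"
    by (simp add: eq hom_mult mult.assoc
        flip: K.linear_apply_sweedler2[OF H.linear_mult_right[OF H.linear_ident]])
  also have "\<dots> = \<pi> a \<leftharpoonup> b"
    using K.absorb_antipode_left[OF left_action_coalgebra_hom tri, of a b] by (simp add: hom_one)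
  finally show ?thesis .
qed

lemma left_action_mult:
  "a \<triangleright> (b * c) = K.sweedler2 (\<lambda>a1 b1 a2 b2. (a1 \<triangleright> b1) * ((a2 \<triangleleft> b2) \<triangleright> c)) a b"
proof -
  have "a \<triangleright> (b * c) = H.sweedler (\<lambda>x1 x2. K.sweedler (\<lambda>b1 b2.
      (x1 \<rightharpoonup> b1) * ((x2 \<leftharpoonup> b2) \<rightharpoonup> c)) b) (\<pi> a)"
    by (simp add: lact_of_hom_def lact_mult H.sweedler_def K.sweedler_def)
  also have "\<dots> = K.sweedler (\<lambda>a1 a2. K.sweedler (\<lambda>b1 b2.
      (\<pi> a1 \<rightharpoonup> b1) * ((\<pi> a2 \<leftharpoonup> b2) \<rightharpoonup> c)) b) a"
    by (rule sweedler_hom[where r = "smul K"], unfold bilinear_map_def)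
      (fast intro: action_linear_rules)
  finally show ?thesis
    by (simp add: K.sweedler2_def lact_of_hom_def hom_right_action)
qed

lemma left_action_one: "a \<triangleright> 1 = smul K (counit K a) 1"
  by (simp add: lact_of_hom_def lact_one counit_hom)

lemma one_left_action: "1 \<triangleright> a = a"
  and mult_left_action: "(a * b) \<triangleright> c = a \<triangleright> (b \<triangleright> c)"
  using left_module_coalgebra
  by (simp_all add: left_module_coalgebra_def lact_of_hom_def hom_one hom_mult)

lemma right_action_one: "a \<triangleleft> 1 = a"
proof -
  have "a \<triangleleft> 1 = K.sweedler (\<lambda>a1 a2. S (a1 \<triangleright> 1) * (a2 * 1)) a"
    unfolding right_action_eq K.sweedler2_def
    by (subst K.sweedler_one[where r = "smul K"], unfold bilinear_map_def)
      (fast intro: action_linear_rules, simp)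
  also have "\<dots> = a"
    using K.linear_antipode K.sweedler_counit_left[OF K.linear_ident, of a]
    by (simp add: left_action_one Vector_Spaces.linear_iff K.antipode_one K.smul_mult_left)
  finally show ?thesis .
qed

lemma one_right_action: "1 \<triangleleft> a = smul K (counit K a) 1"
proof -
  have "1 \<triangleleft> a = K.sweedler (\<lambda>b1 b2. S (1 \<triangleright> b1) * (1 * b2)) a"
    unfolding right_action_eq K.sweedler2_def
    by (rule K.sweedler_one[where r = "smul K"], unfold bilinear_map_def)
      (fast intro: action_linear_rules)
  then show ?thesis by (simp add: one_left_action K.sweedler_antipode)
qed

lemma mult_right_action:
  "(a * b) \<triangleleft> c = K.sweedler2 (\<lambda>b1 c1 b2 c2. (a \<triangleleft> (b1 \<triangleright> c1)) * (b2 \<triangleleft> c2)) b c"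
proof -
  have expand: "p * (q * (b * c)) =
      K.sweedler2 (\<lambda>b1 c1 b2 c2. p * (q * ((b1 \<triangleright> c1) * (b2 \<triangleleft> c2)))) b c" for p q b c
    by (simp add: mult_eq_actions
        flip: K.linear_apply_sweedler2[OF K.linear_mult_right[OF K.linear_ident]])
  have "(a * b) \<triangleleft> c = K.sweedler2 (\<lambda>a1 b1 a2 b2. K.sweedler (\<lambda>c1 c2.
      S ((a1 * b1) \<triangleright> c1) * (a2 * b2 * c2)) c) a b"
    unfolding right_action_eq K.sweedler2_def[of _ "a * b"]
    by (rule K.sweedler_mult[where r = "smul K"], unfold bilinear_map_def)
      (fast intro: action_linear_rules)
  also have "\<dots> = K.sweedler (\<lambda>a1 a2. K.sweedler2 (\<lambda>b1 c1 b2 c2.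
      S (a1 \<triangleright> (b1 \<triangleright> c1)) * (a2 * (b2 * c2))) b c) a"
    by (simp add: K.sweedler2_def mult_left_action mult.assoc)
  also have "\<dots> = K.sweedler (\<lambda>a1 a2. K.sweedler2 (\<lambda>b1 c1 b2 c2. K.sweedler2 (\<lambda>b21 c21 b22 c22.
      S (a1 \<triangleright> (b1 \<triangleright> c1)) * (a2 * ((b21 \<triangleright> c21) * (b22 \<triangleleft> c22)))) b2 c2) b c) a"
    by (intro arg_cong[where f = "\<lambda>G. K.sweedler G _"] arg_cong[where f = "\<lambda>G. K.sweedler2 G _ _"]
        ext expand)
  also have "\<dots> = K.sweedler (\<lambda>a1 a2. K.sweedler2 (\<lambda>b1 c1 b2 c2. K.sweedler2 (\<lambda>b11 c11 b12 c12.
      S (a1 \<triangleright> (b11 \<triangleright> c11)) * (a2 * ((b12 \<triangleright> c12) * (b2 \<triangleleft> c2)))) b1 c1) b c) a"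
    by (intro arg_cong[where f = "\<lambda>G. K.sweedler G _"] ext
        K.sweedler2_coassoc[where r = "smul K", symmetric])
      (unfold K.multilinear6_def, fast intro: action_linear_rules)
  also have "\<dots> = K.sweedler (\<lambda>a1 a2. K.sweedler2 (\<lambda>b1 c1 b2 c2. K.sweedler (\<lambda>d1 d2.
      S (a1 \<triangleright> d1) * (a2 * (d2 * (b2 \<triangleleft> c2)))) (b1 \<triangleright> c1)) b c) a"
    by (subst K.sweedler_coalgebra_hom[OF left_action_coalgebra_hom, where r = "smul K"],
        unfold bilinear_map_def) (fast intro: action_linear_rules, simp)
  also have "\<dots> = K.sweedler2 (\<lambda>b1 c1 b2 c2. K.sweedler (\<lambda>a1 a2. K.sweedler (\<lambda>d1 d2.
      S (a1 \<triangleright> d1) * (a2 * (d2 * (b2 \<triangleleft> c2)))) (b1 \<triangleright> c1)) a) b c"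
    unfolding K.sweedler2_def by (subst K.sweedler_swap, subst (2) K.sweedler_swap) simp
  also have "\<dots> = K.sweedler2 (\<lambda>b1 c1 b2 c2. (a \<triangleleft> (b1 \<triangleright> c1)) * (b2 \<triangleleft> c2)) b c"
    by (simp add: right_action_eq[of _ "_ \<triangleright> _"] K.sweedler2_def[of _ _ "_ \<triangleright> _"] mult.assoc
      K.linear_apply_sweedler[OF K.linear_mult_left[OF K.linear_ident]])
  finally show ?thesis .
qed

text \<open>Both sides are \<open>F\<close> evaluated on the comultiplication of $ab$: expand $ab$ as
  $(a_1 \triangleright b_1)(a_2 \triangleleft b_2)$ after, respectively before, comultiplying.\<close>

lemma comult_mult_eq_actions:
  assumes F: "bilinear_map (smul K) (smul K) r F"
  shows "K.sweedler2 (\<lambda>a1 b1 a2 b2. K.sweedler2 (\<lambda>a21 b21 a22 b22. K.sweedler2 (\<lambda>p1 q1 p2 q2.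
      F ((a1 \<triangleright> b1) * (p1 \<triangleleft> q1)) ((p2 \<triangleright> q2) * (a22 \<triangleleft> b22))) a21 b21) a2 b2) a b =
    K.sweedler2 (\<lambda>a1 b1 a2 b2. K.sweedler2 (\<lambda>a21 b21 a22 b22. K.sweedler2 (\<lambda>p1 q1 p2 q2.
      F ((a1 \<triangleright> b1) * (p2 \<triangleleft> q2)) ((p1 \<triangleright> q1) * (a22 \<triangleleft> b22))) a21 b21) a2 b2) a b"
proof -
  note lin = bilinear_map_compose[OF F] action_linear_rules
  have F1: "Vector_Spaces.linear (smul K) r (\<lambda>x. F x y)" and F2: "Vector_Spaces.linear (smul K) r (F x)" for x y
    using F by (simp_all add: bilinear_map_def)
  have "K.sweedler F (a * b) = K.sweedler2 (\<lambda>a1 b1 a2 b2. F (a1 * b1) (a2 * b2)) a b"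
    by (rule K.sweedler_mult[OF F])
  also have "\<dots> = K.sweedler2 (\<lambda>a1 b1 a2 b2. K.sweedler2 (\<lambda>a11 b11 a12 b12. K.sweedler2 (\<lambda>a21 b21 a22 b22.
      F ((a11 \<triangleright> b11) * (a12 \<triangleleft> b12)) ((a21 \<triangleright> b21) * (a22 \<triangleleft> b22))) a2 b2) a1 b1) a b"
    by (simp add: mult_eq_actions flip: K.linear_apply_sweedler2[OF F1] K.linear_apply_sweedler2[OF F2])
  also have "\<dots> = K.sweedler2 (\<lambda>a1 b1 a2 b2. K.sweedler2 (\<lambda>a21 b21 a22 b22. K.sweedler2 (\<lambda>p1 q1 p2 q2.
      F ((a1 \<triangleright> b1) * (p1 \<triangleleft> q1)) ((p2 \<triangleright> q2) * (a22 \<triangleleft> b22))) a21 b21) a2 b2) a b"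
    by (rule K.sweedler2_middle[where r = r]) (fast intro: lin)+
  finally have 1: "K.sweedler F (a * b) = \<dots>" .
  \<comment> \<open>Second expansion: factor first, then comultiply each factor. The regrouped
    result differs from the first one only by the exchange of the two middle legs.\<close>
  have "K.sweedler F (a * b) = K.sweedler2 (\<lambda>a1 b1 a2 b2. K.sweedler F ((a1 \<triangleright> b1) * (a2 \<triangleleft> b2))) a b"
    by (simp add: mult_eq_actions flip: K.linear_apply_sweedler2[OF K.sweedler_linear[OF F]])
  also have "\<dots> = K.sweedler2 (\<lambda>a1 b1 a2 b2. K.sweedler (\<lambda>x1 x2. K.sweedler (\<lambda>y1 y2.
      F (x1 * y1) (x2 * y2)) (a2 \<triangleleft> b2)) (a1 \<triangleright> b1)) a b"
    by (simp add: K.sweedler_mult[OF F] K.sweedler2_def[of _ "_ \<triangleright> _"])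
  also have "\<dots> = K.sweedler2 (\<lambda>a1 b1 a2 b2. K.sweedler (\<lambda>x1 x2. K.sweedler2 (\<lambda>a21 b21 a22 b22.
      F (x1 * (a21 \<triangleleft> b21)) (x2 * (a22 \<triangleleft> b22))) a2 b2) (a1 \<triangleright> b1)) a b"
    by (subst K.sweedler_coalgebra_hom[OF ract_coalgebra_hom, where r = r],
        unfold bilinear_map_def) (fast intro: lin, simp)
  also have "\<dots> = K.sweedler2 (\<lambda>a1 b1 a2 b2. K.sweedler2 (\<lambda>a11 b11 a12 b12. K.sweedler2 (\<lambda>a21 b21 a22 b22.
      F ((a11 \<triangleright> b11) * (a21 \<triangleleft> b21)) ((a12 \<triangleright> b12) * (a22 \<triangleleft> b22))) a2 b2) a1 b1) a b"
    by (subst K.sweedler_coalgebra_hom[OF left_action_coalgebra_hom, where r = r],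
        unfold bilinear_map_def K.sweedler2_def[of _ "_ :: 'k"]) (fast intro: lin, simp)
  also have "\<dots> = K.sweedler2 (\<lambda>a1 b1 a2 b2. K.sweedler2 (\<lambda>a21 b21 a22 b22. K.sweedler2 (\<lambda>p1 q1 p2 q2.
      F ((a1 \<triangleright> b1) * (p2 \<triangleleft> q2)) ((p1 \<triangleright> q1) * (a22 \<triangleleft> b22))) a21 b21) a2 b2) a b"
    by (rule K.sweedler2_middle[where r = r]) (fast intro: lin)+
  finally have 2: "K.sweedler F (a * b) = \<dots>" .
  show ?thesis using 1 2 by simp
qed

text \<open>In \<open>comult_mult_eq_actions\<close> the middle legs are flanked by a value of
  \<open>\<triangleright>\<close> on the left and one of \<open>\<triangleleft>\<close> on the
  right; both maps are convolution invertible, so the flanks cancel one after the other.\<close>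

lemma action_swap:
  assumes F: "bilinear_map (smul K) (smul K) r F"
  shows "K.sweedler2 (\<lambda>a1 b1 a2 b2. F (a1 \<triangleleft> b1) (a2 \<triangleright> b2)) a b =
    K.sweedler2 (\<lambda>a1 b1 a2 b2. F (a2 \<triangleleft> b2) (a1 \<triangleright> b1)) a b"
proof -
  note lin = bilinear_map_compose[OF F] action_linear_rules
  \<comment> \<open>The multipliers \<open>y\<close> and \<open>z\<close> stay arbitrary:
    \<open>cancel_left\<close> needs all \<open>y\<close>, and the later use of
    \<open>cancel_right\<close> needs all \<open>z\<close>.\<close>
  define A where "A y z a b = K.sweedler2 (\<lambda>a1 b1 a2 b2. K.sweedler2 (\<lambda>p1 q1 p2 q2.
      F (y * (p1 \<triangleleft> q1)) ((p2 \<triangleright> q2) * ((a2 \<triangleleft> b2) * z))) a1 b1) a b" for y z a b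
  define A' where "A' y z a b = K.sweedler2 (\<lambda>a1 b1 a2 b2. K.sweedler2 (\<lambda>p1 q1 p2 q2.
      F (y * (p2 \<triangleleft> q2)) ((p1 \<triangleright> q1) * ((a2 \<triangleleft> b2) * z))) a1 b1) a b" for y z a b
  have "A y z a b = A' y z a b" for y z a b
  proof (rule K.cancel_left[OF left_action_coalgebra_hom, where r = r and A = "\<lambda>y. A y z" and A' = "\<lambda>y. A' y z"])
    show "trilinear_map (smul K) r (\<lambda>y. A y z)" "trilinear_map (smul K) r (\<lambda>y. A' y z)"
      unfolding A_def A'_def trilinear_map_def K.sweedler2_def by (fast intro: lin)+
    \<comment> \<open>Both multipliers are absorbed into the test map, so the uncancelled identity
      applies directly.\<close>
    have "bilinear_map (smul K) (smul K) r (\<lambda>u v. F (y * u) (v * z))" for y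
      unfolding bilinear_map_def by (fast intro: lin)
    from comult_mult_eq_actions[OF this]
    show "K.sweedler2 (\<lambda>a1 b1. A (y * (a1 \<triangleright> b1)) z) a b =
        K.sweedler2 (\<lambda>a1 b1. A' (y * (a1 \<triangleright> b1)) z) a b" for y a b
      by (simp add: A_def[abs_def] A'_def[abs_def] mult.assoc)
  qed
  from this[of 1]
  have cancelled: "K.sweedler2 (\<lambda>a1 b1 a2 b2. K.sweedler2 (\<lambda>p1 q1 p2 q2.
      F (p1 \<triangleleft> q1) ((p2 \<triangleright> q2) * ((a2 \<triangleleft> b2) * z))) a1 b1) a b =
    K.sweedler2 (\<lambda>a1 b1 a2 b2. K.sweedler2 (\<lambda>p1 q1 p2 q2.
      F (p2 \<triangleleft> q2) ((p1 \<triangleright> q1) * ((a2 \<triangleleft> b2) * z))) a1 b1) a b" for z a b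
    by (simp add: A_def A'_def)
  define B where "B z a b = K.sweedler2 (\<lambda>a1 b1 a2 b2. F (a1 \<triangleleft> b1) ((a2 \<triangleright> b2) * z)) a b" for z a b
  define B' where "B' z a b = K.sweedler2 (\<lambda>a1 b1 a2 b2. F (a2 \<triangleleft> b2) ((a1 \<triangleright> b1) * z)) a b" for z a b
  have "B z a b = B' z a b" for z a b
  proof (rule K.cancel_right[OF ract_coalgebra_hom, where r = r and A = B and A' = B'])
    show "trilinear_map (smul K) r B" "trilinear_map (smul K) r B'"
      unfolding B_def B'_def trilinear_map_def K.sweedler2_def by (fast intro: lin)+
    show "K.sweedler2 (\<lambda>a1 b1 a2 b2. B ((a2 \<triangleleft> b2) * z) a1 b1) a b =
        K.sweedler2 (\<lambda>a1 b1 a2 b2. B' ((a2 \<triangleleft> b2) * z) a1 b1) a b" for z a b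
      using cancelled by (simp add: B_def B'_def)
  qed
  from this[of 1] show ?thesis by (simp add: B_def B'_def)
qed

lemma right_action_mult: "a \<triangleleft> (b * c) = (a \<triangleleft> b) \<triangleleft> c"
proof -
  \<comment> \<open>The antipode reverses the product in \<open>left_action_mult\<close> and so puts
    the legs in the wrong order; \<open>action_swap\<close> restores it, so that the last antipode
    factor stands next to the following legs.\<close>
  have S_left_action: "S (a \<triangleright> (b * c)) =
      K.sweedler2 (\<lambda>a1 b1 a2 b2. S ((a1 \<triangleleft> b1) \<triangleright> c) * S (a2 \<triangleright> b2)) a b" for a b c
  proof -
    have "bilinear_map (smul K) (smul K) (smul K) (\<lambda>x y. S (x \<triangleright> c) * S y)"
      unfolding bilinear_map_def by (fast intro: action_linear_rules)
    from action_swap[OF this] show ?thesis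
      by (simp add: left_action_mult K.linear_apply_sweedler2[OF K.linear_antipode] K.antipode_mult)
  qed
  have "a \<triangleleft> (b * c) = K.sweedler (\<lambda>a1 a2. K.sweedler2 (\<lambda>b1 c1 b2 c2.
      S (a1 \<triangleright> (b1 * c1)) * (a2 * (b2 * c2))) b c) a"
    unfolding right_action_eq K.sweedler2_def[of _ a]
    by (subst K.sweedler_mult[where r = "smul K"], unfold bilinear_map_def)
      (fast intro: action_linear_rules, simp)
  also have "\<dots> = K.sweedler2 (\<lambda>a1 b1 a2 b2. K.sweedler (\<lambda>c1 c2.
      S (a1 \<triangleright> (b1 * c1)) * (a2 * (b2 * c2))) c) a b"
    by (simp add: K.sweedler2_def)
  also have "\<dots> = K.sweedler2 (\<lambda>a1 b1 a2 b2. K.sweedler (\<lambda>c1 c2. K.sweedler2 (\<lambda>a11 b11 a12 b12.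
      S ((a11 \<triangleleft> b11) \<triangleright> c1) * (S (a12 \<triangleright> b12) * (a2 * (b2 * c2)))) a1 b1) c) a b"
    by (simp add: S_left_action mult.assoc
        K.linear_apply_sweedler2[OF K.linear_mult_left[OF K.linear_ident]])
  also have "\<dots> = K.sweedler2 (\<lambda>a1 b1 a2 b2. K.sweedler2 (\<lambda>a11 b11 a12 b12. K.sweedler (\<lambda>c1 c2.
      S ((a11 \<triangleleft> b11) \<triangleright> c1) * (S (a12 \<triangleright> b12) * (a2 * (b2 * c2)))) c) a1 b1) a b"
    unfolding K.sweedler2_def by (subst (3) K.sweedler_swap, subst (4) K.sweedler_swap) simp
  also have "\<dots> = K.sweedler2 (\<lambda>a1 b1 a2 b2. K.sweedler2 (\<lambda>a21 b21 a22 b22. K.sweedler (\<lambda>c1 c2.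
      S ((a1 \<triangleleft> b1) \<triangleright> c1) * (S (a21 \<triangleright> b21) * (a22 * (b22 * c2)))) c) a2 b2) a b"
    by (rule K.sweedler2_coassoc[where r = "smul K"])
      (unfold K.multilinear6_def, fast intro: action_linear_rules)
  also have "\<dots> = K.sweedler2 (\<lambda>a1 b1 a2 b2. K.sweedler (\<lambda>c1 c2.
      S ((a1 \<triangleleft> b1) \<triangleright> c1) * ((a2 \<triangleleft> b2) * c2)) c) a b"
  proof -
    have "K.sweedler2 (\<lambda>a1 b1 a2 b2. K.sweedler (\<lambda>c1 c2.
        S (x \<triangleright> c1) * (S (a1 \<triangleright> b1) * (a2 * (b2 * c2)))) c) a b =
      K.sweedler (\<lambda>c1 c2. S (x \<triangleright> c1) * ((a \<triangleleft> b) * c2)) c" for x a b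
    proof -
      have "Vector_Spaces.linear (smul K) (smul K) (\<lambda>y. K.sweedler (\<lambda>c1 c2. S (x \<triangleright> c1) * (y * c2)) c)"
        by (fast intro: action_linear_rules)
      from K.linear_apply_sweedler2[OF this] show ?thesis
        by (simp add: right_action_eq[of a b] mult.assoc)
    qed
    then show ?thesis by simp
  qed
  also have "\<dots> = K.sweedler (\<lambda>x1 x2. K.sweedler (\<lambda>c1 c2. S (x1 \<triangleright> c1) * (x2 * c2)) c) (a \<triangleleft> b)"
    by (rule K.sweedler_coalgebra_hom[OF ract_coalgebra_hom, where r = "smul K", symmetric],
        unfold bilinear_map_def) (fast intro: action_linear_rules)
  also have "\<dots> = (a \<triangleleft> b) \<triangleleft> c"
    by (simp add: right_action_eq[of "a \<triangleleft> b"] K.sweedler2_def)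
  finally show ?thesis .
qed

section \<open>Verification of the axioms\<close>

lemma matched_pair_of_actions: "matched_pair_of_actions K (\<triangleright>) (\<triangleleft>)"
proof unfold_locales
  show "left_module_coalgebra K K (\<triangleright>)"
    by (simp add: left_module_coalgebra_def left_action_coalgebra_hom mult_left_action one_left_action)
  show "right_module_coalgebra K K (\<triangleleft>)"
    by (simp add: right_module_coalgebra_def ract_coalgebra_hom right_action_mult right_action_one)
  fix x y a b
  show "x \<triangleright> (a * b) = (\<Sum>(x1, x2)\<leftarrow>comult K x. \<Sum>(a1, a2)\<leftarrow>comult K a.
      (x1 \<triangleright> a1) * ((x2 \<triangleleft> a2) \<triangleright> b))"
    using left_action_mult[of x a b] by (simp add: K.sweedler_def K.sweedler2_def)
  show "x \<triangleright> 1 = smul K (counit K x) 1"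
    by (rule left_action_one)
  show "(x * y) \<triangleleft> a = (\<Sum>(y1, y2)\<leftarrow>comult K y. \<Sum>(a1, a2)\<leftarrow>comult K a.
      (x \<triangleleft> (y1 \<triangleright> a1)) * (y2 \<triangleleft> a2))"
    using mult_right_action[of x y a] by (simp add: K.sweedler_def K.sweedler2_def)
  show "1 \<triangleleft> a = smul K (counit K a) 1"
    by (rule one_right_action)
  show "x * y = (\<Sum>(x1, x2)\<leftarrow>comult K x. \<Sum>(y1, y2)\<leftarrow>comult K y. (x1 \<triangleright> y1) * (x2 \<triangleleft> y2))"
    using mult_eq_actions[of x y] by (simp add: K.sweedler_def K.sweedler2_def)
  show "tensor_eq (smul K) (smul K)
      [(x1 \<triangleright> a1, x2 \<triangleleft> a2). (x1, x2) \<leftarrow> comult K x, (a1, a2) \<leftarrow> comult K a]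
      [(x2 \<triangleright> a2, x1 \<triangleleft> a1). (x1, x2) \<leftarrow> comult K x, (a1, a2) \<leftarrow> comult K a]"
  proof (rule tensor_eqI[OF K.vector_space_axioms K.vector_space_axioms])
    fix f assume "bilinear_map (smul K) (smul K) (smul K) f"
    \<comment> \<open>The test map is flipped because \<open>action_swap\<close> lists the value of
      \<open>\<triangleleft>\<close> first, whereas the axiom lists that of
      \<open>\<triangleright>\<close> first.\<close>
    then have "bilinear_map (smul K) (smul K) (smul K) (\<lambda>u v. f v u)"
      by (simp add: bilinear_map_def)
    from action_swap[OF this, of x a]
    show "(\<Sum>(u, v)\<leftarrow>[(x1 \<triangleright> a1, x2 \<triangleleft> a2). (x1, x2) \<leftarrow> comult K x, (a1, a2) \<leftarrow> comult K a]. f u v) =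
      (\<Sum>(u, v)\<leftarrow>[(x2 \<triangleright> a2, x1 \<triangleleft> a1). (x1, x2) \<leftarrow> comult K x, (a1, a2) \<leftarrow> comult K a]. f u v)"
      by (simp add: K.sweedler2_def K.sweedler_def case_prod_unfold sum_list_map_concat comp_def)
  qed
qed

end

theorem theorem5p1:
  fixes H :: "('f::field, 'h::ring_1) hopf" and K :: "('f, 'k::ring_1) hopf"
    and lact :: "'h \<Rightarrow> 'k \<Rightarrow> 'k" (infix "\<rightharpoonup>" 75)
    and ract :: "'h \<Rightarrow> 'k \<Rightarrow> 'h" (infix "\<leftharpoonup>" 75)
    and \<pi> :: "'k \<Rightarrow> 'h"
  assumes "matched_pair H K (\<rightharpoonup>) (\<leftharpoonup>)"
    and "hopf_hom K H \<pi>"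
    and "\<And>a x. (\<Sum>(x1, x2)\<leftarrow>comult H x. \<Sum>(a1, a2)\<leftarrow>comult K a. \<pi> (x1 \<rightharpoonup> a1) * (x2 \<leftharpoonup> a2))
        = x * \<pi> a"
    and "tensor_coalgebra_hom K K K (ract_of_hom K (\<rightharpoonup>) \<pi>)"
  shows "matched_pair_of_actions K (lact_of_hom (\<rightharpoonup>) \<pi>) (ract_of_hom K (\<rightharpoonup>) \<pi>)"
proof -
  interpret matched_pair_hom H K "(\<rightharpoonup>)" "(\<leftharpoonup>)" \<pi>
    using assms by (intro matched_pair_hom.intro matched_pair_hom_axioms.intro)
  show ?thesis by (rule matched_pair_of_actions)
qed

end
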